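(* For every tree $T$ with $n\ge1$ vertices there exists a monotone (and hence planar) straight-line drawing of $T$ in which the vertices are placed at distinct integer grid points lying in a grid of $\lfloor\frac{3}{4}(n+2)\rfloor\times\lfloor\frac{3}{4}(n+2)\rfloor$ points, i.e., the $x$-coordinates of the vertices span an interval of length at most $\lfloor\frac{3}{4}(n+2)\rfloor-1$, and likewise the $y$-coordinates.
   Context: A path $p_0,\dots,p_k$ in a straight-line drawing is monotone if there is a line $\ell$ such that the orthogonal projections of $p_0,\dots,p_k$ onto $\ell$ appear along $\ell$ in this order. A straight-line drawing of a graph is monotone if every pair of vertices is connected by a monotone path. No order of neighbors around vertices is prescribed. *)

theory Defs
  imports "HOL-Analysis.Analysis"
begin

definition graph_walk :: "('a \<Rightarrow> 'a \<Rightarrow> bool) \<Rightarrow> 'a list \<Rightarrow> bool" where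
  "graph_walk E xs \<longleftrightarrow> (\<forall>i. Suc i < length xs \<longrightarrow> E (xs ! i) (xs ! Suc i))"

definition is_tree :: "'a set \<Rightarrow> ('a \<Rightarrow> 'a \<Rightarrow> bool) \<Rightarrow> bool" where
  "is_tree V E \<longleftrightarrow>
     finite V \<and> V \<noteq> {} \<and>
     (\<forall>u v. E u v \<longrightarrow> u \<in> V \<and> v \<in> V \<and> u \<noteq> v \<and> E v u) \<and>
     (\<forall>u\<in>V. \<forall>v\<in>V. \<exists>xs. xs \<noteq> [] \<and> hd xs = u \<and> last xs = v \<and> set xs \<subseteq> V \<and> graph_walk E xs) \<and>
     \<not> (\<exists>xs. 3 \<le> length xs \<and> distinct xs \<and> graph_walk E xs \<and> E (last xs) (hd xs))"

definition rpos :: "('a \<Rightarrow> int \<times> int) \<Rightarrow> 'a \<Rightarrow> real \<times> real" where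
  "rpos p v = (real_of_int (fst (p v)), real_of_int (snd (p v)))"

definition monotone_path :: "('a \<Rightarrow> int \<times> int) \<Rightarrow> 'a list \<Rightarrow> bool" where
  "monotone_path p xs \<longleftrightarrow>
     (\<exists>d :: real \<times> real. d \<noteq> 0 \<and>
        (\<forall>i. Suc i < length xs \<longrightarrow> inner d (rpos p (xs ! i)) < inner d (rpos p (xs ! Suc i))))"

definition monotone_drawing :: "'a set \<Rightarrow> ('a \<Rightarrow> 'a \<Rightarrow> bool) \<Rightarrow> ('a \<Rightarrow> int \<times> int) \<Rightarrow> bool" where
  "monotone_drawing V E p \<longleftrightarrow>
     (\<forall>u\<in>V. \<forall>v\<in>V. \<exists>xs. xs \<noteq> [] \<and> hd xs = u \<and> last xs = v \<and> graph_walk E xs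
                          \<and> monotone_path p xs)"

definition planar_drawing :: "('a \<Rightarrow> 'a \<Rightarrow> bool) \<Rightarrow> ('a \<Rightarrow> int \<times> int) \<Rightarrow> bool" where
  "planar_drawing E p \<longleftrightarrow>
     (\<forall>a b c d. E a b \<longrightarrow> E c d \<longrightarrow> {a, b} \<noteq> {c, d} \<longrightarrow>
        closed_segment (rpos p a) (rpos p b) \<inter> closed_segment (rpos p c) (rpos p d)
          \<subseteq> rpos p ` ({a, b} \<inter> {c, d}))"

end

theory Submission
  imports Defs
begin

text \<open>
  Direct the edges of a rooted tree away from the root and give them vectors in the first quadrant.
  If at every vertex the branches use disjoint angular sectors, then the path between two vertices
  consists of reversed vectors of one sector followed by vectors of another one, so it is monotone
  in the direction of a normal of a line separating the sectors; the same line keeps the segments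
  of the two branches apart.

  Measured by arc length in the maximum norm, the quadrant has length 2, and a sector of length f
  contains a lattice vector of norm at most 3 / (2 f), unless f > 3/4 and no vector of norm 1 is
  available. Splitting sectors in proportion to the numbers of edges draws a tree with m edges within
  distance 3 m / (2 f) of its root. Finally, every tree with m \<ge> 2 edges has a vertex at which it
  splits into two trees with at most 3 m / 4 edges each; they share the quadrant, and all
  coordinates are at most 3 m / 4.
\<close>

section \<open>Rooted trees\<close>

text \<open>In \<open>rooted_tree m r V D\<close>, the number of edges is m and D holds the edges as pairs (parent, child).\<close>

inductive rooted_tree :: "nat \<Rightarrow> 'a \<Rightarrow> 'a set \<Rightarrow> ('a \<times> 'a) set \<Rightarrow> bool" where
  single: "rooted_tree 0 r {r} {}"
| extend: "rooted_tree m v V D \<Longrightarrow> r \<notin> V \<Longrightarrow> rooted_tree (Suc m) r (insert r V) (insert (r, v) D)"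
| join: "rooted_tree m1 r V1 D1 \<Longrightarrow> rooted_tree m2 r V2 D2 \<Longrightarrow> V1 \<inter> V2 = {r} \<Longrightarrow> 0 < m1 \<Longrightarrow> 0 < m2 \<Longrightarrow>
    rooted_tree (m1 + m2) r (V1 \<union> V2) (D1 \<union> D2)"

lemma rooted_tree_root: "rooted_tree m r V D \<Longrightarrow> r \<in> V"
  by (induction rule: rooted_tree.induct) auto

lemma rooted_tree_finite: "rooted_tree m r V D \<Longrightarrow> finite V \<and> finite D"
  by (induction rule: rooted_tree.induct) auto

lemma rooted_tree_edges: "rooted_tree m r V D \<Longrightarrow> D \<subseteq> V \<times> V"
  by (induction rule: rooted_tree.induct) (auto dest: rooted_tree_root)

lemma rooted_tree_card: "rooted_tree m r V D \<Longrightarrow> card V = Suc m"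
proof (induction rule: rooted_tree.induct)
  case (extend m v V D r)
  then show ?case using rooted_tree_finite[of m v V D] by simp
next
  case (join m1 r V1 D1 m2 V2 D2)
  have "card V1 + card V2 = card (V1 \<union> V2) + card (V1 \<inter> V2)"
    using rooted_tree_finite[OF join(1)] rooted_tree_finite[OF join(2)] by (intro card_Un_Int) simp_all
  then show ?case using join by simp
qed simp

lemma rooted_tree_reach: "rooted_tree m r V D \<Longrightarrow> v \<in> V \<Longrightarrow> (r, v) \<in> D\<^sup>*"
proof (induction arbitrary: v rule: rooted_tree.induct)
  case (extend m u V D r)
  show ?case
  proof (cases "v = r")
    case False
    then have "(u, v) \<in> D\<^sup>*" using extend by blast
    then have "(u, v) \<in> (insert (r, u) D)\<^sup>*" by (rule rtrancl_mono[THEN subsetD, rotated]) blast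
    then show ?thesis by (meson converse_rtrancl_into_rtrancl insertI1)
  qed simp
next
  case (join m1 r V1 D1 m2 V2 D2)
  then show ?case by (auto intro: in_rtrancl_UnI)
qed simp

lemma rooted_tree_0: "rooted_tree 0 r V D \<Longrightarrow> V = {r} \<and> D = {}"
  by (erule rooted_tree.cases) auto

text \<open>The rule \<open>join\<close> requires an edge on both sides, which makes both parts
  strictly smaller in inductions. A part without edges is just the root and is absorbed by the other
  part.\<close>

lemma rooted_tree_join:
  assumes "rooted_tree m1 r V1 D1" "rooted_tree m2 r V2 D2" "V1 \<inter> V2 = {r}"
  shows "rooted_tree (m1 + m2) r (V1 \<union> V2) (D1 \<union> D2)"
proof (cases "0 < m1 \<and> 0 < m2")
  case True
  with assms show ?thesis by (intro rooted_tree.join) simp_all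
next
  case False
  then consider "m1 = 0" | "m2 = 0" by blast
  then show ?thesis
  proof cases
    case 1
    then have "V1 = {r}" "D1 = {}" using assms(1) rooted_tree_0[of r V1 D1] by auto
    moreover have "insert r V2 = V2" using rooted_tree_root[OF assms(2)] by auto
    ultimately show ?thesis using 1 assms(2) by simp
  next
    case 2
    then have "V2 = {r}" "D2 = {}" using assms(2) rooted_tree_0[of r V2 D2] by auto
    moreover have "insert r V1 = V1" using rooted_tree_root[OF assms(1)] by auto
    ultimately show ?thesis using 2 assms(1) by simp
  qed
qed

lemma rooted_tree_edge: "u \<noteq> w \<Longrightarrow> rooted_tree (Suc 0) u {u, w} {(u, w)}"
  using rooted_tree.extend[OF rooted_tree.single[of w], of u] by simp

text \<open>Serves to grow spanning trees. The leaf goes into the part that contains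
  \<open>u\<close>; if \<open>u\<close> is the root of a \<open>single\<close> or
  \<open>extend\<close> tree, a one-edge tree is attached there.\<close>

lemma rooted_tree_add_leaf:
  assumes "rooted_tree m r V D" "u \<in> V" "w \<notin> V"
  shows "rooted_tree (Suc m) r (insert w V) (insert (u, w) D)"
  using assms
proof (induction rule: rooted_tree.induct)
  case (single r)
  then show ?case using rooted_tree_edge[of r w] by (simp add: insert_commute)
next
  case (extend m v V D r)
  show ?case
  proof (cases "u = r")
    case True
    have "rooted_tree (Suc 0 + Suc m) r ({r, w} \<union> insert r V) ({(r, w)} \<union> insert (r, v) D)"
      using extend by (intro rooted_tree_join rooted_tree_edge rooted_tree.extend) auto
    moreover have "{r, w} \<union> insert r V = insert w (insert r V)" by auto
    ultimately show ?thesis using True by (simp add: insert_commute)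
  next
    case False
    then have "rooted_tree (Suc (Suc m)) r (insert r (insert w V)) (insert (r, v) (insert (u, w) D))"
      using extend by (intro rooted_tree.extend) auto
    then show ?thesis by (simp add: insert_commute)
  qed
next
  case (join m1 r V1 D1 m2 V2 D2)
  show ?case
  proof (cases "u \<in> V1")
    case True
    have "rooted_tree (Suc m1 + m2) r (insert w V1 \<union> V2) (insert (u, w) D1 \<union> D2)"
      using True join by (intro rooted_tree.join) auto
    then show ?thesis by simp
  next
    case False
    have "rooted_tree (m1 + Suc m2) r (V1 \<union> insert w V2) (D1 \<union> insert (u, w) D2)"
      using False join by (intro rooted_tree.join) auto
    then show ?thesis by simp
  qed
qed

text \<open>Moving the root to \<open>u\<close> may reverse edges, so the edge sets are compared
  after symmetric closure.\<close>

definition balanced_split :: "nat \<Rightarrow> 'a set \<Rightarrow> ('a \<times> 'a) set \<Rightarrow> bool" where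
  "balanced_split m V D \<longleftrightarrow> (\<exists>a b u A B DA DB. rooted_tree a u A DA \<and> rooted_tree b u B DB \<and> A \<inter> B = {u} \<and>
     b \<le> a \<and> a + b = m \<and> 4 * a \<le> 3 * m \<and> A \<union> B = V \<and> (DA \<union> DB) \<union> (DA \<union> DB)\<inverse> = D \<union> D\<inverse>)"

lemma balanced_splitI:
  assumes "rooted_tree a u A DA" "rooted_tree b u B DB" "A \<inter> B = {u}" "b \<le> a" "4 * a \<le> 3 * (a + b)"
  shows "balanced_split (a + b) (A \<union> B) (DA \<union> DB)"
  unfolding balanced_split_def
  by (rule exI[of _ a], rule exI[of _ b], rule exI[of _ u], rule exI[of _ A], rule exI[of _ B], rule exI[of _ DA], rule exI[of _ DB]) (use assms in simp)

lemma balanced_split_cong: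
  "D \<union> D\<inverse> = D' \<union> D'\<inverse> \<Longrightarrow> balanced_split m V D \<longleftrightarrow> balanced_split m V D'"
  by (simp add: balanced_split_def)

text \<open>While the heavier side is too heavy, moving the root along its only edge, or moving the
  lighter half of the heavier side to the other side, makes it lighter.\<close>

lemma ex_balanced_split:
  assumes "rooted_tree m1 r V1 D1" "rooted_tree m2 r V2 D2" "V1 \<inter> V2 = {r}" "m2 \<le> m1" "2 \<le> m1 + m2"
  shows "balanced_split (m1 + m2) (V1 \<union> V2) (D1 \<union> D2)"
  using assms
proof (induction m1 arbitrary: r V1 D1 m2 V2 D2 rule: less_induct)
  case (less m1)
  \<comment> \<open>Either new side may become the heavier one, so both must have fewer than
    \<open>m1\<close> edges for the induction hypothesis.\<close>
  have step: "balanced_split (a + b) (A \<union> B) (DA \<union> DB)"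
    if "a < m1" "b < m1" "rooted_tree a u A DA" "rooted_tree b u B DB" "A \<inter> B = {u}" "2 \<le> a + b"
    for a b and u :: 'a and A B DA DB
  proof (cases "b \<le> a")
    case True
    then show ?thesis using less.IH[of a u A DA b B DB] that by simp
  next
    case False
    then have "balanced_split (b + a) (B \<union> A) (DB \<union> DA)"
      using less.IH[of b u B DB a A DA] that by (simp add: Int_commute)
    then show ?thesis by (simp only: Un_commute add.commute)
  qed
  show ?case
  proof (cases "4 * m1 \<le> 3 * (m1 + m2)")
    case True
    then show ?thesis using less.prems by (intro balanced_splitI)
  next
    case False
    from less.prems(1) show ?thesis
    proof cases
      case single
      then show ?thesis using less.prems by simp
    next
      case (extend m v V D)
      have r: "r \<in> V2" "v \<in> V" "v \<notin> V2"
        using less.prems(3) extend rooted_tree_root[OF less.prems(2)] rooted_tree_root[OF extend(4)] by auto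
      \<comment> \<open>The edge between \<open>r\<close> and \<open>v\<close> changes sides,
        reversed. The lighter side stays below \<open>m1\<close> because \<open>m1 > 3 * m2\<close>
        and \<open>m1 + m2 >= 2\<close>.\<close>
      have "V \<inter> insert v V2 = {v}" using less.prems(3) extend r by auto
      moreover have "rooted_tree (Suc m2) v (insert v V2) (insert (v, r) D2)"
        using less.prems(2) r(3) by (rule rooted_tree.extend)
      ultimately have "balanced_split (m + Suc m2) (V \<union> insert v V2) (D \<union> insert (v, r) D2)"
        using extend less.prems(4,5) False by (intro step[of m "Suc m2" v]) simp_all
      moreover have "V \<union> insert v V2 = V1 \<union> V2" "m + Suc m2 = m1 + m2"
        using extend r by auto
      moreover have "(D \<union> insert (v, r) D2) \<union> (D \<union> insert (v, r) D2)\<inverse> = (D1 \<union> D2) \<union> (D1 \<union> D2)\<inverse>"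
        unfolding extend by blast
      ultimately show ?thesis using balanced_split_cong by metis
    next
      case (join a A DA b B DB)
      have *: "balanced_split (m1 + m2) (V1 \<union> V2) (D1 \<union> D2)"
        if ab: "rooted_tree a' r A' DA'" "rooted_tree b' r B' DB'" "b' \<le> a'" "0 < b'" "a' + b' = m1"
          "A' \<inter> B' = {r}" "A' \<union> B' = V1" "DA' \<union> DB' = D1" for a' b' A' B' DA' DB'
      proof -
        \<comment> \<open>The enlarged side has \<open>b' + m2 < m1\<close> edges, since
          \<open>b' <= m1 / 2\<close> and \<open>m2 < m1 / 3\<close>.\<close>
        have "B' \<inter> V2 = {r}" "A' \<inter> (B' \<union> V2) = {r}"
          using ab(6,7) less.prems(3) rooted_tree_root[OF ab(2)] by blast+
        then have "balanced_split (a' + (b' + m2)) (A' \<union> (B' \<union> V2)) (DA' \<union> (DB' \<union> D2))"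
          using ab(1-5) less.prems(2,4,5) False by (intro step[of a' "b' + m2" r] rooted_tree_join) simp_all
        then show ?thesis using ab(5,7,8) by (simp only: Un_assoc[symmetric] add.assoc[symmetric])
      qed
      show ?thesis
      proof (cases "b \<le> a")
        case True
        then show ?thesis using *[of a A DA b B DB] join by simp
      next
        case False
        then show ?thesis using *[of b B DB a A DA] join by (simp add: Un_commute Int_commute)
      qed
    qed
  qed
qed

section \<open>Monotone planar drawings of rooted trees\<close>

definition height :: "real \<times> real \<Rightarrow> int \<times> int \<Rightarrow> real" where
  "height d z = fst d * of_int (fst z) + snd d * of_int (snd z)"

lemma height_uminus [simp]: "height (- d) z = - height d z"
  by (simp add: height_def)

lemma inner_rpos: "inner d (rpos p v) = height d (p v)"
  by (cases d) (simp add: rpos_def height_def)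

text \<open>Edges may be used in either orientation as long as they rise along \<open>d\<close>. The
  reflexive transitive closure then expresses monotone paths, and concatenation is
  transitivity.\<close>

definition ascent :: "('a \<times> 'a) set \<Rightarrow> ('a \<Rightarrow> int \<times> int) \<Rightarrow> real \<times> real \<Rightarrow> 'a \<Rightarrow> 'a \<Rightarrow> bool" where
  "ascent D p d a b \<longleftrightarrow> (a, b) \<in> D \<union> D\<inverse> \<and> height d (p a) < height d (p b)"

definition segs_meet :: "('a \<Rightarrow> int \<times> int) \<Rightarrow> 'a \<times> 'a \<Rightarrow> 'a \<times> 'a \<Rightarrow> bool" where
  "segs_meet p e f \<longleftrightarrow> closed_segment (rpos p (fst e)) (rpos p (snd e)) \<inter>
     closed_segment (rpos p (fst f)) (rpos p (snd f)) \<subseteq> rpos p ` ({fst e, snd e} \<inter> {fst f, snd f})"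

definition mono_planar :: "'a set \<Rightarrow> ('a \<times> 'a) set \<Rightarrow> ('a \<Rightarrow> int \<times> int) \<Rightarrow> bool" where
  "mono_planar V D p \<longleftrightarrow> (\<forall>u\<in>V. \<forall>v\<in>V. \<exists>d. d \<noteq> 0 \<and> (ascent D p d)\<^sup>*\<^sup>* u v) \<and>
     (\<forall>e\<in>D. \<forall>f\<in>D. e \<noteq> f \<longrightarrow> segs_meet p e f)"

lemma segs_meet_commute: "segs_meet p e f \<longleftrightarrow> segs_meet p f e"
  by (simp add: segs_meet_def Int_commute)

lemma ascent_rev: "(ascent D p d)\<^sup>*\<^sup>* u v \<Longrightarrow> (ascent D p (- d))\<^sup>*\<^sup>* v u"
proof (induction rule: rtranclp_induct)
  case (step y z)
  then have "ascent D p (- d) z y" by (auto simp: ascent_def height_def)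
  then show ?case using step by (meson converse_rtranclp_into_rtranclp)
qed simp

lemma ascent_mono: "(ascent D p d)\<^sup>*\<^sup>* u v \<Longrightarrow> D \<subseteq> D' \<Longrightarrow> (ascent D' p d)\<^sup>*\<^sup>* u v"
  by (erule rtranclp_mono[THEN predicate2D, rotated]) (auto simp: ascent_def)

lemma ascent_reach:
  assumes "(u, v) \<in> D\<^sup>*" "\<And>a b. (a, b) \<in> D \<Longrightarrow> height d (p a) < height d (p b)"
  shows "(ascent D p d)\<^sup>*\<^sup>* u v"
  using assms(1)
proof (induction rule: rtrancl_induct)
  case (step y z)
  then show ?case using assms(2) by (meson UnI1 ascent_def rtranclp.rtrancl_into_rtrancl)
qed simp

lemma ascent_less: "(ascent D p d)\<^sup>*\<^sup>* u v \<Longrightarrow> u = v \<or> height d (p u) < height d (p v)"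
  by (induction rule: rtranclp_induct) (auto simp: ascent_def)

lemma mono_planar_cong:
  assumes "mono_planar V D p" "D \<subseteq> V \<times> V" "\<And>v. v \<in> V \<Longrightarrow> q v = p v"
  shows "mono_planar V D q"
proof -
  have "ascent D p d = ascent D q d" for d
    using assms(2,3) by (fastforce simp: ascent_def fun_eq_iff)
  moreover have "segs_meet q e f" if "e \<in> D" "f \<in> D" "segs_meet p e f" for e f
  proof -
    have "fst e \<in> V" "snd e \<in> V" "fst f \<in> V" "snd f \<in> V" using that assms(2) by auto
    then have "rpos q (fst e) = rpos p (fst e)" "rpos q (snd e) = rpos p (snd e)"
      "rpos q (fst f) = rpos p (fst f)" "rpos q (snd f) = rpos p (snd f)"
      by (simp_all add: rpos_def assms(3))
    moreover from this have "rpos q ` ({fst e, snd e} \<inter> {fst f, snd f}) = rpos p ` ({fst e, snd e} \<inter> {fst f, snd f})"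
      by (intro image_cong) auto
    ultimately show ?thesis using that(3) unfolding segs_meet_def by simp
  qed
  ultimately show ?thesis using assms(1) unfolding mono_planar_def by auto
qed

text \<open>On a segment falling from \<open>A\<close> to \<open>B\<close> a linear functional is
  maximal at \<open>A\<close> only, so a point reaching the bound \<open>c\<close> must be
  \<open>A\<close>.\<close>

lemma segment_top:
  fixes A B :: "real \<times> real"
  assumes "z \<in> closed_segment A B" "inner d B < inner d A" "inner d A \<le> c" "c \<le> inner d z"
  shows "z = A \<and> inner d A = c"
proof -
  obtain t where t: "0 \<le> t" "t \<le> 1" "z = (1 - t) *\<^sub>R A + t *\<^sub>R B"
    using assms(1) by (auto simp: in_segment)
  have "inner d z = inner d A - t * (inner d A - inner d B)"
    unfolding t by (simp add: inner_add_right algebra_simps)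
  then have "t * (inner d A - inner d B) \<le> 0" "inner d A - inner d B > 0" using assms by linarith+
  then have "t = 0" using t by (simp add: mult_le_0_iff)
  then show ?thesis using t assms by simp
qed

text \<open>Since everything rises along \<open>d\<close>, the level of \<open>v\<close> separates
  the new edge, below it, from the segments of \<open>D\<close>, on or above it. Paths from
  \<open>r\<close> simply follow the tree edges.\<close>

lemma mono_planar_extend:
  assumes "rooted_tree m v V D" "r \<notin> V" "mono_planar V D p" "d \<noteq> 0"
    and up: "\<And>a b. (a, b) \<in> insert (r, v) D \<Longrightarrow> height d (p a) < height d (p b)"
  shows "mono_planar (insert r V) (insert (r, v) D) p"
proof -
  let ?D = "insert (r, v) D"
  have rt: "rooted_tree (Suc m) r (insert r V) ?D" using assms by (intro rooted_tree.extend)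
  have fwd: "(ascent ?D p d)\<^sup>*\<^sup>* r w" if "w \<in> insert r V" for w
    using rooted_tree_reach[OF rt that] up by (rule ascent_reach)
  have bwd: "(ascent ?D p (- d))\<^sup>*\<^sup>* w r" if "w \<in> insert r V" for w
    using fwd[OF that] by (rule ascent_rev)
  have mono: "\<exists>d. d \<noteq> 0 \<and> (ascent ?D p d)\<^sup>*\<^sup>* u w" if uw: "u \<in> insert r V" "w \<in> insert r V" for u w
  proof -
    consider "u = r" | "w = r" | "u \<in> V" "w \<in> V" using uw by blast
    then show ?thesis
    proof cases
      case 1 then show ?thesis using fwd uw assms(4) by blast
    next
      case 2
      moreover have "- d \<noteq> 0" using assms(4) by simp
      ultimately show ?thesis using bwd uw by blast
    next
      case 3 then show ?thesis using assms(3) ascent_mono[of D p _ u w ?D] unfolding mono_planar_def by blast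
    qed
  qed
  have new: "segs_meet p (r, v) (c, e)" if "(c, e) \<in> D" for c e
    unfolding segs_meet_def fst_conv snd_conv
  proof
    fix z assume z: "z \<in> closed_segment (rpos p r) (rpos p v) \<inter> closed_segment (rpos p c) (rpos p e)"
    have "c \<in> V" using that rooted_tree_edges[OF assms(1)] by auto
    then have vc: "v = c \<or> height d (p v) < height d (p c)"
      using ascent_less[OF ascent_reach[OF rooted_tree_reach[OF assms(1)]]] up by blast
    have le: "inner d z \<le> inner d (rpos p v)"
    proof (rule ccontr)
      assume *: "\<not> ?thesis"
      then have "z = rpos p v"
        using segment_top[of z "rpos p v" "rpos p r" d "inner d (rpos p v)"] z up[of r v]
        by (auto simp: inner_rpos closed_segment_commute)
      then show False using * by simp
    qed
    \<comment> \<open>With respect to \<open>- d\<close>, the end \<open>c\<close> is the top of its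
      segment and at most at the level of \<open>v\<close>, while \<open>le\<close> puts
      \<open>z\<close> at least there.\<close>
    have "z = rpos p c \<and> inner (- d) (rpos p c) = inner (- d) (rpos p v)"
      by (rule segment_top[of _ _ "rpos p e"]) (use z le vc up[of c e] that in \<open>auto simp: inner_rpos\<close>)
    then have "c = v" "z = rpos p v" using vc by (auto simp: inner_rpos)
    then show "z \<in> rpos p ` ({r, v} \<inter> {c, e})" by auto
  qed
  have planar: "segs_meet p e f" if ef: "e \<in> ?D" "f \<in> ?D" "e \<noteq> f" for e f
  proof -
    consider "e \<in> D" "f \<in> D" | "e = (r, v)" "f \<in> D" | "e \<in> D" "f = (r, v)" using ef by blast
    then show ?thesis
      using new[of "fst f" "snd f"] new[of "fst e" "snd e"] segs_meet_commute[of p e f] assms(3) ef(3)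
      by cases (auto simp: mono_planar_def)
  qed
  show ?thesis unfolding mono_planar_def by (intro conjI ballI impI mono planar)
qed

text \<open>The line through \<open>r\<close> orthogonal to \<open>d\<close> separates the two trees
  and meets them in \<open>r\<close> only. A path from \<open>V1\<close> to \<open>V2\<close> rises
  to \<open>r\<close> and then continues to rise away from it.\<close>

lemma mono_planar_join:
  assumes t1: "rooted_tree m1 r V1 D1" and t2: "rooted_tree m2 r V2 D2"
    and "mono_planar V1 D1 p" "mono_planar V2 D2 p" "d \<noteq> 0"
    and down: "\<And>a b. (a, b) \<in> D1 \<Longrightarrow> height d (p b) < height d (p a)"
    and up: "\<And>a b. (a, b) \<in> D2 \<Longrightarrow> height d (p a) < height d (p b)"
  shows "mono_planar (V1 \<union> V2) (D1 \<union> D2) p"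
proof -
  let ?D = "D1 \<union> D2"
  have a1: "(ascent D1 p (- d))\<^sup>*\<^sup>* r u" if "u \<in> V1" for u
    using rooted_tree_reach[OF t1 that] by (rule ascent_reach) (simp add: down)
  have a2: "(ascent D2 p d)\<^sup>*\<^sup>* r u" if "u \<in> V2" for u
    using rooted_tree_reach[OF t2 that] up by (rule ascent_reach)
  have cross: "(ascent ?D p d)\<^sup>*\<^sup>* u w" if "u \<in> V1" "w \<in> V2" for u w
    using ascent_mono[OF ascent_rev[OF a1[OF that(1)]], of ?D] ascent_mono[OF a2[OF that(2)], of ?D] by simp
  have mono: "\<exists>d. d \<noteq> 0 \<and> (ascent ?D p d)\<^sup>*\<^sup>* u w" if uw: "u \<in> V1 \<union> V2" "w \<in> V1 \<union> V2" for u w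
  proof -
    consider "u \<in> V1" "w \<in> V1" | "u \<in> V2" "w \<in> V2" | "u \<in> V1" "w \<in> V2" | "u \<in> V2" "w \<in> V1" using uw by blast
    then show ?thesis
    proof cases
      case 1 then show ?thesis using assms(3) ascent_mono[of D1 p _ u w ?D] unfolding mono_planar_def by blast
    next
      case 2 then show ?thesis using assms(4) ascent_mono[of D2 p _ u w ?D] unfolding mono_planar_def by blast
    next
      case 3 then show ?thesis using cross assms(5) by blast
    next
      case 4
      have "- d \<noteq> 0" using assms(5) by simp
      then show ?thesis using ascent_rev[OF cross[OF 4(2,1)]] by blast
    qed
  qed
  have new: "segs_meet p (a, b) (c, e)" if "(a, b) \<in> D1" "(c, e) \<in> D2" for a b c e
    unfolding segs_meet_def fst_conv snd_conv
  proof
    fix z assume z: "z \<in> closed_segment (rpos p a) (rpos p b) \<inter> closed_segment (rpos p c) (rpos p e)"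
    have "a \<in> V1" "c \<in> V2" using that rooted_tree_edges[OF t1] rooted_tree_edges[OF t2] by auto
    then have ra: "r = a \<or> height d (p a) < height d (p r)" and rc: "r = c \<or> height d (p r) < height d (p c)"
      using ascent_less[OF a1] ascent_less[OF a2] by auto
    have ineq: "inner d (rpos p a) \<le> inner d (rpos p r)" "inner (- d) (rpos p c) \<le> inner (- d) (rpos p r)"
      "inner d (rpos p b) < inner d (rpos p a)" "inner (- d) (rpos p e) < inner (- d) (rpos p c)"
      using ra rc up down that by (auto simp: inner_rpos)
    have *: "z = rpos p a \<and> inner d (rpos p a) = inner d (rpos p r)" if "inner d (rpos p r) \<le> inner d z"
      by (rule segment_top[of _ _ "rpos p b"]) (use z ineq that in auto)
    have **: "z = rpos p c \<and> inner (- d) (rpos p c) = inner (- d) (rpos p r)" if "inner (- d) (rpos p r) \<le> inner (- d) z"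
      by (rule segment_top[of _ _ "rpos p e"]) (use z ineq that in auto)
    \<comment> \<open>Whichever side of the level of \<open>r\<close> the point \<open>z\<close> is
      on, one of the two preceding facts applies and puts it on that level; then both apply.\<close>
    have "inner d z = inner d (rpos p r)"
      by (cases "inner d (rpos p r) \<le> inner d z") (use * ** in \<open>simp_all add: inner_rpos\<close>)
    then have za: "z = rpos p a" "height d (p a) = height d (p r)" and zc: "height d (p c) = height d (p r)"
      using * ** by (simp_all add: inner_rpos)
    have "a = r" using ra za(2) by simp
    moreover have "c = r" using rc zc by simp
    ultimately show "z \<in> rpos p ` ({a, b} \<inter> {c, e})" using za(1) by simp
  qed
  have planar: "segs_meet p e f" if ef: "e \<in> ?D" "f \<in> ?D" "e \<noteq> f" for e f
  proof -
    consider "e \<in> D1" "f \<in> D1" | "e \<in> D2" "f \<in> D2" | "e \<in> D1" "f \<in> D2" | "e \<in> D2" "f \<in> D1" using ef by blast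
    then show ?thesis
      using new[of "fst e" "snd e" "fst f" "snd f"] new[of "fst f" "snd f" "fst e" "snd e"]
        segs_meet_commute[of p e f] assms(3,4) ef(3)
      by cases (auto simp: mono_planar_def)
  qed
  show ?thesis unfolding mono_planar_def by (intro conjI ballI impI mono planar)
qed

section \<open>Directions in a sector\<close>

text \<open>The non-negative vector w points to the point at distance ang w, measured from (1, 0), on the
  polygonal line through (1, 0), (1, 1) and (0, 1). Lattice points of maximum norm N lie
  at the multiples of 1 / N, so every half-open interval of length 1 / N contains one of them.\<close>

definition ang :: "int \<times> int \<Rightarrow> real" where
  "ang w = (if snd w \<le> fst w then of_int (snd w) / of_int (fst w) else 2 - of_int (fst w) / of_int (snd w))"

text \<open>Half-open, so that adjacent sectors are disjoint. The condition on the sum excludes the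
  zero vector, whose \<open>ang\<close> would be the default value \<open>0 / 0 = 0\<close>.\<close>

definition dir_in :: "real \<Rightarrow> real \<Rightarrow> int \<times> int \<Rightarrow> bool" where
  "dir_in s t w \<longleftrightarrow> 0 \<le> fst w \<and> 0 \<le> snd w \<and> 0 < fst w + snd w \<and> s \<le> ang w \<and> ang w < t"

lemma height_diff: "height d (a - b) = height d a - height d b"
  by (simp add: height_def algebra_simps)

lemma dir_in_mono: "dir_in s t w \<Longrightarrow> s' \<le> s \<Longrightarrow> t \<le> t' \<Longrightarrow> dir_in s' t' w"
  by (simp add: dir_in_def)

lemma dir_in_height: "dir_in s t w \<Longrightarrow> 0 < height (1, 1) w"
  unfolding dir_in_def height_def by simp

text \<open>For \<open>c\<close> between 0 and 2, the point at distance \<open>c\<close> on the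
  polygonal line is \<open>(min 1 (2 - c), min 1 c)\<close>; this vector is its left turn by a right
  angle.\<close>

definition normal :: "real \<Rightarrow> real \<times> real" where
  "normal c = (- min 1 c, min 1 (2 - c))"

lemma normal_nonzero: "normal c \<noteq> 0"
  by (auto simp: normal_def zero_prod_def min_def)

lemma height_normal_neg:
  assumes "dir_in s t w" "ang w < c" "0 \<le> c" "c \<le> 2"
  shows "height (normal c) w < 0"
proof -
  define x y :: real where "x = of_int (fst w)" and "y = of_int (snd w)"
  have xy: "0 \<le> x" "0 \<le> y" "0 < x + y" using assms(1) unfolding dir_in_def x_def y_def by linarith+
  have h: "height (normal c) w = - min 1 c * x + min 1 (2 - c) * y"
    by (simp add: height_def normal_def x_def y_def)
  have a: "ang w = (if y \<le> x then y / x else 2 - x / y)" by (simp add: ang_def x_def y_def)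
  show ?thesis
  proof (cases "y \<le> x")
    case True
    then have "0 < x" using xy by linarith
    then have yx: "y < c * x" using assms(2) a True by (simp add: field_simps)
    show ?thesis
    proof (cases "c \<le> 1")
      case True
      then show ?thesis using yx h by simp
    next
      case False
      then have "(2 - c) * y \<le> (2 - c) * x" using \<open>y \<le> x\<close> assms(4) by (intro mult_left_mono) auto
      moreover have "(2 - c) * x < 1 * x" using False \<open>0 < x\<close> by (intro mult_strict_right_mono) auto
      ultimately show ?thesis using h False by simp
    qed
  next
    case False
    then have "0 < y" using xy by linarith
    then have "(2 - c) * y < x" "x / y < 1" using assms(2) a False by (simp_all add: field_simps)
    moreover from this have "1 < c" using assms(2) a False by simp
    ultimately show ?thesis using h by simp
  qed
qed

lemma height_normal_pos:
  assumes "dir_in s t w" "c < ang w" "0 \<le> c" "c \<le> 2"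
  shows "0 < height (normal c) w"
proof -
  define x y :: real where "x = of_int (fst w)" and "y = of_int (snd w)"
  have xy: "0 \<le> x" "0 \<le> y" "0 < x + y" using assms(1) unfolding dir_in_def x_def y_def by linarith+
  have h: "height (normal c) w = - min 1 c * x + min 1 (2 - c) * y"
    by (simp add: height_def normal_def x_def y_def)
  have a: "ang w = (if y \<le> x then y / x else 2 - x / y)" by (simp add: ang_def x_def y_def)
  show ?thesis
  proof (cases "y \<le> x")
    case True
    then have "0 < x" using xy by linarith
    then have "c * x < y" "y / x \<le> 1" using assms(2) a True by (simp_all add: field_simps)
    moreover from this have "c < 1" using assms(2) a True by simp
    ultimately show ?thesis using h by simp
  next
    case False
    then have "0 < y" using xy by linarith
    then have yx: "x < (2 - c) * y" using assms(2) a False by (simp add: field_simps)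
    show ?thesis
    proof (cases "c \<le> 1")
      case True
      then have "c * x \<le> 1 * x" using xy by (intro mult_right_mono) auto
      then show ?thesis using h True False by simp
    next
      case False
      then show ?thesis using yx h by simp
    qed
  qed
qed

text \<open>Going \<open>k\<close> unit steps along the polygonal line scaled by \<open>N\<close>
  leads to \<open>(N, k)\<close> on the first side and to \<open>(2 * N - k, N)\<close> on the
  second.\<close>

lemma ang_lattice_point:
  fixes k N :: int
  assumes "0 < N" "0 \<le> k" "s \<le> of_int k / of_int N" "of_int k / of_int N < t" "t \<le> 2"
  shows "\<exists>w. dir_in s t w \<and> fst w \<le> N \<and> snd w \<le> N"
proof -
  have "of_int k / of_int N < (2 :: real)" using assms by linarith
  then have "of_int k < (of_int (2 * N) :: real)" using assms(1) by (simp add: field_simps)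
  then have k: "k < 2 * N" by linarith
  show ?thesis
  proof (cases "k \<le> N")
    case True
    then have "dir_in s t (N, k)" using assms by (auto simp: dir_in_def ang_def)
    then show ?thesis using True by (intro exI[of _ "(N, k)"]) simp
  next
    case False
    then have "ang (2 * N - k, N) = of_int k / of_int N" using assms(1) by (simp add: ang_def field_simps)
    then have "dir_in s t (2 * N - k, N)" using assms k by (auto simp: dir_in_def)
    then show ?thesis using False by (intro exI[of _ "(2 * N - k, N)"]) simp
  qed
qed

text \<open>Sectors in which a vector of maximum norm at most 3/2 divided by the length of the sector is
  available. Beyond length 3/4, rounding up the reciprocal of the length costs more than the factor
  3/2, and an integer is needed as a vector of norm 1.\<close>

definition wide :: "real \<Rightarrow> real \<Rightarrow> bool" where
  "wide s t \<longleftrightarrow> 0 \<le> s \<and> s < t \<and> t \<le> 2 \<and> t - s \<le> 3 / 2 \<and> (t - s \<le> 3 / 4 \<or> (\<exists>k::int. s \<le> of_int k \<and> of_int k < t))"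

text \<open>A half-open interval of length \<open>f\<close> contains a multiple of
  \<open>1 / N\<close> once \<open>N >= 1 / f\<close>. Rounding \<open>1 / f\<close> up costs at
  most the factor 3/2 if \<open>f <= 1 / 2\<close>, and also for larger \<open>f\<close> up to
  \<open>3 / 4\<close>, where \<open>N = 2\<close>; an integer in the interval allows
  \<open>N = 1\<close>.\<close>

lemma wide_vector:
  assumes "wide s t"
  shows "\<exists>w. dir_in s t w \<and> of_int (fst w) \<le> 3 / 2 / (t - s) \<and> of_int (snd w) \<le> 3 / 2 / (t - s)"
proof -
  define f where "f = t - s"
  have f: "0 < f" "f \<le> 3 / 2" "0 \<le> s" "t \<le> 2" using assms by (auto simp: wide_def f_def)
  have "\<exists>k N :: int. 0 < N \<and> s \<le> of_int k / of_int N \<and> of_int k / of_int N < t \<and> of_int N \<le> 3 / 2 / f"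
  proof (cases "\<exists>k::int. s \<le> of_int k \<and> of_int k < t")
    case True
    then obtain k :: int where "s \<le> of_int k" "of_int k < t" by blast
    moreover have "1 \<le> 3 / 2 / f" using f by (simp add: field_simps)
    ultimately show ?thesis by (intro exI[of _ k] exI[of _ 1]) simp
  next
    case False
    then have f34: "f \<le> 3 / 4" using assms by (auto simp: wide_def f_def)
    define N where "N = \<lceil>1 / f\<rceil>"
    define k where "k = \<lceil>s * of_int N\<rceil>"
    have N: "1 / f \<le> of_int N" unfolding N_def by linarith
    have "0 < 1 / f" using f by simp
    then have N0: "(0 :: real) < of_int N" using N by linarith
    have "of_int N \<le> 3 / 2 / f"
    proof (cases "f \<le> 1 / 2")
      case True
      have "of_int N < 1 / f + 1" unfolding N_def by linarith
      also have "\<dots> \<le> 3 / 2 / f" using True f by (simp add: field_simps)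
      finally show ?thesis by simp
    next
      case False
      then have "1 / f \<le> of_int 2" using f by (simp add: field_simps)
      then have "N \<le> 2" unfolding N_def by (simp only: ceiling_le_iff)
      then have "of_int N \<le> (2 :: real)" by linarith
      also have "\<dots> \<le> 3 / 2 / f" using f34 f by (simp add: field_simps)
      finally show ?thesis .
    qed
    moreover have "s \<le> of_int k / of_int N"
      using N0 by (simp add: k_def pos_le_divide_eq)
    moreover have "of_int k / of_int N < t"
    proof -
      have "of_int k < s * of_int N + 1" unfolding k_def by linarith
      also have "1 \<le> f * of_int N" using N f by (simp add: field_simps)
      finally have "of_int k < t * of_int N" by (simp add: f_def algebra_simps)
      then show ?thesis using N0 by (simp add: pos_divide_less_eq)
    qed
    ultimately show ?thesis using N0 by (intro exI[of _ k] exI[of _ N]) simp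
  qed
  then obtain k N :: int where kN: "0 < N" "s \<le> of_int k / of_int N" "of_int k / of_int N < t" "of_int N \<le> 3 / 2 / f"
    by blast
  have "(0 :: real) \<le> of_int k / of_int N" using kN(2) f by linarith
  then have "0 \<le> k" using kN(1) by (simp add: zero_le_divide_iff)
  then obtain w where w: "dir_in s t w" "fst w \<le> N" "snd w \<le> N"
    using ang_lattice_point[OF kN(1) _ kN(2,3) f(4)] by blast
  have "real_of_int (fst w) \<le> of_int N" "real_of_int (snd w) \<le> of_int N" using w by simp_all
  then have "of_int (fst w) \<le> 3 / 2 / f" "of_int (snd w) \<le> 3 / 2 / f" using kN(4) by linarith+
  then show ?thesis using w(1) unfolding f_def by blast
qed

section \<open>Drawing a rooted tree in a sector\<close>

definition in_box :: "int \<times> int \<Rightarrow> real \<Rightarrow> int \<times> int \<Rightarrow> bool" where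
  "in_box z B q \<longleftrightarrow> fst z \<le> fst q \<and> of_int (fst q) \<le> of_int (fst z) + B \<and>
     snd z \<le> snd q \<and> of_int (snd q) \<le> of_int (snd z) + B"

definition drawing ::
  "int \<times> int \<Rightarrow> 'a \<Rightarrow> 'a set \<Rightarrow> ('a \<times> 'a) set \<Rightarrow> real \<Rightarrow> real \<Rightarrow> real \<Rightarrow> ('a \<Rightarrow> int \<times> int) \<Rightarrow> bool" where
  "drawing z r V D s t B p \<longleftrightarrow> p r = z \<and> (\<forall>a b. (a, b) \<in> D \<longrightarrow> dir_in s t (p b - p a)) \<and>
     (\<forall>v\<in>V. in_box z B (p v)) \<and> mono_planar V D p"

text \<open>Free choice of the root position and of the sector lets an induction shift subtrees and
  hand out parts of a sector.\<close>

definition drawable :: "nat \<Rightarrow> 'a \<Rightarrow> 'a set \<Rightarrow> ('a \<times> 'a) set \<Rightarrow> bool" where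
  "drawable m r V D \<longleftrightarrow> (\<forall>z s t. wide s t \<longrightarrow> (\<exists>p. drawing z r V D s t (3 / 2 * real m / (t - s)) p))"

text \<open>The boundary \<open>c\<close> may itself be a direction of the second tree, so the
  separating direction \<open>c'\<close> is taken strictly between the finitely many angles of
  \<open>D1\<close> and \<open>c\<close>.\<close>

lemma drawing_join:
  assumes t1: "rooted_tree m1 r V1 D1" and t2: "rooted_tree m2 r V2 D2" and V: "V1 \<inter> V2 = {r}"
    and st: "0 \<le> s" "s < c" "c < t" "t \<le> 2"
    and p1: "drawing z r V1 D1 s c B p1" and p2: "drawing z r V2 D2 c t B p2"
  shows "\<exists>p. drawing z r (V1 \<union> V2) (D1 \<union> D2) s t B p"
proof -
  define p where "p = (\<lambda>v. if v \<in> V1 then p1 v else p2 v)"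
  have pr: "p1 r = z" "p2 r = z" using p1 p2 by (auto simp: drawing_def)
  have e1: "p v = p1 v" if "v \<in> V1" for v using that by (simp add: p_def)
  have e2: "p v = p2 v" if "v \<in> V2" for v
  proof (cases "v \<in> V1")
    case True
    then have "v = r" using that V by auto
    then show ?thesis using pr by (simp add: p_def)
  qed (simp add: p_def)
  have d1: "dir_in s c (p b - p a)" if "(a, b) \<in> D1" for a b
    using p1 that rooted_tree_edges[OF t1] e1 unfolding drawing_def by auto
  have d2: "dir_in c t (p b - p a)" if "(a, b) \<in> D2" for a b
    using p2 that rooted_tree_edges[OF t2] e2 unfolding drawing_def by auto
  \<comment> \<open>Including \<open>s\<close> keeps the maximum defined when \<open>D1\<close> is
    empty and makes \<open>c'\<close> nonnegative.\<close>
  define S where "S = insert s ((\<lambda>(a, b). ang (p b - p a)) ` D1)"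
  define c' where "c' = (Max S + c) / 2"
  have fin: "finite S" using rooted_tree_finite[OF t1] by (simp add: S_def)
  have ne: "S \<noteq> {}" by (simp add: S_def)
  have "x < c" if "x \<in> S" for x
    using that d1 st unfolding S_def dir_in_def by auto
  then have Mc: "Max S < c" using Max_in[OF fin ne] by blast
  have "s \<le> Max S" using fin by (intro Max_ge) (auto simp: S_def)
  then have c': "0 \<le> c'" "c' \<le> 2" "c' < c" "Max S < c'" using Mc st by (auto simp: c'_def)
  have lt: "ang (p b - p a) < c'" if "(a, b) \<in> D1" for a b
  proof -
    have "ang (p b - p a) \<in> S" unfolding S_def using that by force
    then have "ang (p b - p a) \<le> Max S" using fin by simp
    then show ?thesis using c' by linarith
  qed
  have "mono_planar (V1 \<union> V2) (D1 \<union> D2) p"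
  proof (rule mono_planar_join[OF t1 t2 _ _ normal_nonzero[of c']])
    show "mono_planar V1 D1 p"
      using p1 rooted_tree_edges[OF t1] e1 by (intro mono_planar_cong[of V1 D1 p1 p]) (auto simp: drawing_def)
    show "mono_planar V2 D2 p"
      using p2 rooted_tree_edges[OF t2] e2 by (intro mono_planar_cong[of V2 D2 p2 p]) (auto simp: drawing_def)
    show "height (normal c') (p b) < height (normal c') (p a)" if "(a, b) \<in> D1" for a b
      using height_normal_neg[OF d1[OF that] lt[OF that] c'(1,2)] by (simp add: height_diff)
    show "height (normal c') (p a) < height (normal c') (p b)" if "(a, b) \<in> D2" for a b
    proof -
      have "c' < ang (p b - p a)" using d2[OF that] c' by (simp add: dir_in_def)
      then show ?thesis using height_normal_pos[OF d2[OF that] _ c'(1,2)] by (simp add: height_diff)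
    qed
  qed
  moreover have "p r = z" using e1[OF rooted_tree_root[OF t1]] pr by simp
  moreover have "dir_in s t (p b - p a)" if "(a, b) \<in> D1 \<union> D2" for a b
    using that dir_in_mono[OF d1, of a b s t] dir_in_mono[OF d2, of a b s t] st by auto
  moreover have "in_box z B (p v)" if "v \<in> V1 \<union> V2" for v
    using that p1 p2 e1 e2 by (auto simp: drawing_def)
  ultimately show ?thesis unfolding drawing_def by blast
qed

lemma drawable_single: "drawable 0 r {r} {}"
proof -
  have "mono_planar {r} {} (\<lambda>_. z)" for z
    unfolding mono_planar_def by (auto intro!: exI[of _ "(1, 1)"] simp: zero_prod_def)
  then have "drawing z r {r} {} s t 0 (\<lambda>_. z)" for z s t
    by (simp add: drawing_def in_box_def)
  then show ?thesis unfolding drawable_def of_nat_0 mult_zero_right div_0 by blast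
qed

text \<open>The new edge gets a short vector \<open>w\<close> of the sector, and the old tree is
  drawn in the same sector starting from \<open>z + w\<close>. The box grows by
  \<open>3 / 2 / f\<close>, the share of one edge.\<close>

lemma drawable_extend:
  assumes t: "rooted_tree m v V D" and r: "r \<notin> V" and "drawable m v V D"
  shows "drawable (Suc m) r (insert r V) (insert (r, v) D)"
  unfolding drawable_def
proof (intro allI impI)
  fix z s t assume st: "wide s t"
  define f where "f = t - s"
  have "0 < f" using st by (simp add: f_def wide_def)
  obtain w where w: "dir_in s t w" "of_int (fst w) \<le> 3 / 2 / f" "of_int (snd w) \<le> 3 / 2 / f"
    using wide_vector[OF st] unfolding f_def by blast
  obtain q where q: "drawing (z + w) v V D s t (3 / 2 * real m / f) q"
    using assms(3) st unfolding drawable_def f_def by blast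
  define p where "p = q(r := z)"
  have e: "p u = q u" if "u \<in> V" for u using that r by (auto simp: p_def)
  have "p v = z + w" using q e[OF rooted_tree_root[OF t]] by (simp add: drawing_def)
  moreover have "p r = z" by (simp add: p_def)
  ultimately have dir: "dir_in s t (p b - p a)" if "(a, b) \<in> insert (r, v) D" for a b
    using that w(1) q rooted_tree_edges[OF t] e unfolding drawing_def by auto
  have "mono_planar V D p"
    using q rooted_tree_edges[OF t] e by (intro mono_planar_cong[of V D q p]) (auto simp: drawing_def)
  then have "mono_planar (insert r V) (insert (r, v) D) p"
  proof (rule mono_planar_extend[OF t r])
    show "(1, 1) \<noteq> (0 :: real \<times> real)" by (simp add: zero_prod_def)
    show "height (1, 1) (p a) < height (1, 1) (p b)" if "(a, b) \<in> insert (r, v) D" for a b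
      using dir_in_height[OF dir[OF that]] by (simp add: height_diff)
  qed
  moreover have "in_box z (3 / 2 * real (Suc m) / f) (p u)" if "u \<in> insert r V" for u
  proof (cases "u = r")
    case True
    then show ?thesis using \<open>p r = z\<close> \<open>0 < f\<close> by (simp add: in_box_def)
  next
    case False
    then have "in_box (z + w) (3 / 2 * real m / f) (p u)" using that q e unfolding drawing_def by auto
    moreover have "3 / 2 * real (Suc m) / f = 3 / 2 / f + 3 / 2 * real m / f"
      using \<open>0 < f\<close> by (simp add: field_simps)
    moreover have "0 \<le> fst w" "0 \<le> snd w" using w(1) by (simp_all add: dir_in_def)
    ultimately show ?thesis using w(2,3) unfolding in_box_def by simp
  qed
  ultimately show "\<exists>p. drawing z r (insert r V) (insert (r, v) D) s t (3 / 2 * real (Suc m) / (t - s)) p"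
    using \<open>p r = z\<close> dir unfolding drawing_def f_def by blast
qed

text \<open>The sector is divided in proportion to the numbers of edges, which keeps the quotient of the two
  constant. The heavier part takes at least half of the sector, so one of the two orders gives it
  the integer that the sector may have to contain.\<close>

lemma drawable_join_heavy:
  assumes t1: "rooted_tree m1 r V1 D1" and t2: "rooted_tree m2 r V2 D2" and V: "V1 \<inter> V2 = {r}"
    and m: "0 < m2" "m2 \<le> m1" and "drawable m1 r V1 D1" "drawable m2 r V2 D2"
  shows "drawable (m1 + m2) r (V1 \<union> V2) (D1 \<union> D2)"
  unfolding drawable_def
proof (intro allI impI)
  fix z s t assume st: "wide s t"
  define f f1 f2 where "f = t - s" and "f1 = f * m1 / (m1 + m2)" and "f2 = f * m2 / (m1 + m2)"
  have f: "0 < f" "f \<le> 3 / 2" "0 \<le> s" "t \<le> 2" using st by (auto simp: wide_def f_def)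
  have pos: "0 < f1" "0 < f2" using f m by (auto simp: f1_def f2_def)
  have sum: "f1 + f2 = f"
    using m by (simp add: f1_def f2_def add_divide_distrib[symmetric] distrib_left[symmetric])
  have "f2 \<le> f1" unfolding f1_def f2_def using f m by (intro divide_right_mono mult_left_mono) auto
  \<comment> \<open>The lighter share is at most half of a sector of length at most 3/2, so it is
    wide in either position.\<close>
  then have le: "f2 \<le> 3 / 4" using sum f by linarith
  let ?B = "3 / 2 * real (m1 + m2) / f"
  have B: "3 / 2 * real m1 / f1 = ?B" "3 / 2 * real m2 / f2 = ?B"
    using m f by (simp_all add: f1_def f2_def field_simps)
  have ex1: "\<exists>p. drawing z r V1 D1 a (a + f1) ?B p" if "wide a (a + f1)" for a
    using assms(6) that B(1) unfolding drawable_def by fastforce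
  have ex2: "\<exists>p. drawing z r V2 D2 a (a + f2) ?B p" if "wide a (a + f2)" for a
    using assms(7) that B(2) unfolding drawable_def by fastforce
  have t: "s + f1 + f2 = t" "s + f2 + f1 = t" using sum by (simp_all add: f_def)
  show "\<exists>p. drawing z r (V1 \<union> V2) (D1 \<union> D2) s t (3 / 2 * real (m1 + m2) / (t - s)) p"
  proof (cases "wide s (s + f1)")
    case True
    moreover have "wide (s + f1) (s + f1 + f2)" using f pos sum le t by (simp add: wide_def)
    ultimately obtain p1 p2 where "drawing z r V1 D1 s (s + f1) ?B p1" "drawing z r V2 D2 (s + f1) t ?B p2"
      using ex1 ex2 t by metis
    then have "\<exists>p. drawing z r (V1 \<union> V2) (D1 \<union> D2) s t ?B p"
      using pos f t by (intro drawing_join[OF t1 t2 V, of s "s + f1" t]) auto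
    then show ?thesis by (simp only: f_def)
  next
    case False
    \<comment> \<open>With \<open>f1 > 3 / 4\<close> the whole sector must contain an integer
      \<open>k\<close>. It is not among the first \<open>f1\<close>, hence lies beyond
      \<open>s + f2\<close>, and the heavier part can go last.\<close>
    then have nw: "\<not> f1 \<le> 3 / 4" "\<And>k::int. s \<le> of_int k \<Longrightarrow> \<not> of_int k < s + f1"
      using f pos t sum by (auto simp: wide_def)
    then obtain k :: int where k: "s \<le> of_int k" "of_int k < t"
      using st pos sum by (auto simp: wide_def f_def)
    have "s + f2 \<le> of_int k" using nw(2)[OF k(1)] \<open>f2 \<le> f1\<close> by linarith
    then have "wide (s + f2) (s + f2 + f1)" using f pos sum t k by (auto simp: wide_def)
    moreover have "wide s (s + f2)" using f pos sum le t by (simp add: wide_def)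
    ultimately obtain p1 p2 where "drawing z r V2 D2 s (s + f2) ?B p2" "drawing z r V1 D1 (s + f2) t ?B p1"
      using ex1 ex2 t by metis
    then have "\<exists>p. drawing z r (V2 \<union> V1) (D2 \<union> D1) s t ?B p"
      using V pos f t by (intro drawing_join[OF t2 t1, of s "s + f2" t]) auto
    then show ?thesis by (simp only: Un_commute f_def)
  qed
qed

lemma rooted_tree_drawable: "rooted_tree m r V D \<Longrightarrow> drawable m r V D"
proof (induction rule: rooted_tree.induct)
  case (single r)
  show ?case by (rule drawable_single)
next
  case (extend m v V D r)
  then show ?case by (intro drawable_extend)
next
  case (join m1 r V1 D1 m2 V2 D2)
  show ?case
  proof (cases "m2 \<le> m1")
    case True
    then show ?thesis using join by (intro drawable_join_heavy)
  next
    case False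
    then have "drawable (m2 + m1) r (V2 \<union> V1) (D2 \<union> D1)"
      using join by (intro drawable_join_heavy) (simp_all add: Int_commute)
    then show ?thesis by (simp only: Un_commute add.commute)
  qed
qed

section \<open>Unrooted trees\<close>

lemma rtranclp_walk: "R\<^sup>*\<^sup>* u v \<Longrightarrow> \<exists>xs. xs \<noteq> [] \<and> hd xs = u \<and> last xs = v \<and> successively R xs"
proof (induction rule: converse_rtranclp_induct)
  case base
  show ?case by (rule exI[of _ "[v]"]) simp
next
  case (step y z)
  then obtain xs where "xs \<noteq> []" "hd xs = z" "last xs = v" "successively R xs" by blast
  then show ?case using step by (intro exI[of _ "y # xs"]) (simp add: successively_Cons)
qed

lemma graph_walk_rtranclp:
  assumes "graph_walk E xs" "xs \<noteq> []"
  shows "E\<^sup>*\<^sup>* (hd xs) (last xs)"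
proof -
  have "i < length xs \<Longrightarrow> E\<^sup>*\<^sup>* (xs ! 0) (xs ! i)" for i
  proof (induction i)
    case (Suc i)
    then show ?case using assms(1) unfolding graph_walk_def by (meson Suc_lessD rtranclp.rtrancl_into_rtrancl)
  qed simp
  then show ?thesis using assms(2) by (simp add: hd_conv_nth last_conv_nth)
qed

lemma rtranclp_leaves_set:
  "E\<^sup>*\<^sup>* u v \<Longrightarrow> u \<in> S \<Longrightarrow> v \<notin> S \<Longrightarrow> \<exists>a b. a \<in> S \<and> b \<notin> S \<and> E a b"
  by (induction rule: rtranclp_induct) auto

lemma successively_ascent_distinct:
  assumes "successively (ascent D p d) xs"
  shows "distinct xs"
proof -
  have "successively (<) (map (\<lambda>v. height d (p v)) xs)"
    unfolding successively_map using assms by (rule successively_mono) (simp add: ascent_def)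
  then have "sorted_wrt (<) (map (\<lambda>v. height d (p v)) xs)"
    by (simp add: successively_conv_sorted_wrt)
  then have "distinct (map (\<lambda>v. height d (p v)) xs)" by (simp only: strict_sorted_iff)
  then show ?thesis by (simp add: distinct_map)
qed

text \<open>A maximal vertex set carrying a rooted tree is all of \<open>V\<close>: otherwise a walk
  to a missing vertex leaves the set by an edge whose far end can be added as a leaf.\<close>

lemma ex_spanning_rooted_tree:
  assumes "is_tree V E"
  shows "\<exists>m r D. rooted_tree m r V D \<and> (\<forall>(u, v)\<in>D. E u v)"
proof -
  let ?F = "{S \<in> Pow V. \<exists>m r D. rooted_tree m r S D \<and> (\<forall>(u, v)\<in>D. E u v)}"
  have V: "finite V" "V \<noteq> {}" using assms by (auto simp: is_tree_def)
  then obtain r0 where "r0 \<in> V" by blast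
  then have "{r0} \<in> ?F" using rooted_tree.single[of r0] by fastforce
  then obtain S where S: "S \<in> ?F" and max: "\<And>S'. S' \<in> ?F \<Longrightarrow> S \<subseteq> S' \<Longrightarrow> S = S'"
    using finite_has_maximal[of ?F] V(1) by (metis (no_types, lifting) empty_iff finite_Pow_iff finite_subset mem_Collect_eq subsetI)
  obtain m r D where D: "rooted_tree m r S D" "\<forall>(u, v)\<in>D. E u v" "S \<subseteq> V" using S by auto
  have "S = V"
  proof (rule ccontr)
    assume "S \<noteq> V"
    then obtain w where w: "w \<in> V" "w \<notin> S" using D(3) by blast
    have rS: "r \<in> S" using rooted_tree_root[OF D(1)] .
    then have "r \<in> V" using D(3) by blast
    then obtain xs where "xs \<noteq> []" "hd xs = r" "last xs = w" "graph_walk E xs"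
      using assms w(1) unfolding is_tree_def by blast
    then have "E\<^sup>*\<^sup>* r w" using graph_walk_rtranclp by blast
    then obtain a b where ab: "a \<in> S" "b \<notin> S" "E a b" using rtranclp_leaves_set rS w(2) by metis
    have "b \<in> V" using assms ab(3) unfolding is_tree_def by blast
    then have "insert b S \<in> ?F" using rooted_tree_add_leaf[OF D(1) ab(1,2)] D(2,3) ab(3) by fastforce
    then show False using max[of "insert b S"] ab(2) by blast
  qed
  then show ?thesis using D by blast
qed

text \<open>The ends of an edge outside the spanning tree would be joined by a simple path in the
  tree, closing a cycle. Simplicity is obtained from a drawing: heights strictly increase along a
  monotone path.\<close>

lemma tree_rooted_tree:
  assumes "is_tree V E"
  shows "\<exists>m r D. rooted_tree m r V D \<and> (\<forall>u v. E u v \<longleftrightarrow> (u, v) \<in> D \<union> D\<inverse>)"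
proof -
  obtain m r D where D: "rooted_tree m r V D" "\<forall>(u, v)\<in>D. E u v"
    using ex_spanning_rooted_tree[OF assms] by blast
  have sym: "E v u" "u \<in> V" "v \<in> V" "u \<noteq> v" if "E u v" for u v
    using assms that unfolding is_tree_def by blast+
  have sub: "E u v" if "(u, v) \<in> D \<union> D\<inverse>" for u v using that D(2) sym(1) by auto
  have "wide 0 1" unfolding wide_def by (auto intro: exI[of _ 0])
  then obtain p where p: "mono_planar V D p"
    using rooted_tree_drawable[OF D(1)] unfolding drawable_def drawing_def by blast
  have "(u, v) \<in> D \<union> D\<inverse>" if uv: "E u v" for u v
  proof (rule ccontr)
    assume no: "(u, v) \<notin> D \<union> D\<inverse>"
    obtain d where "(ascent D p d)\<^sup>*\<^sup>* u v"
      using p sym(2,3)[OF uv] unfolding mono_planar_def by blast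
    then obtain xs where xs: "xs \<noteq> []" "hd xs = u" "last xs = v" "successively (ascent D p d) xs"
      using rtranclp_walk by metis
    have "graph_walk E xs"
      using successively_nth[OF xs(4)] sub unfolding graph_walk_def ascent_def by blast
    \<comment> \<open>Length 1 would give \<open>u = v\<close>, and length 2 would put the missing
      edge into \<open>D\<close> in one of its orientations.\<close>
    moreover have "3 \<le> length xs"
    proof (cases xs rule: remdups_adj.cases)
      case (3 x y ys)
      then show ?thesis using xs no by (cases ys) (auto simp: ascent_def)
    qed (use xs sym(4)[OF uv] in auto)
    moreover have "E (last xs) (hd xs)" using xs sym(1)[OF uv] by simp
    ultimately show False
      using assms successively_ascent_distinct[OF xs(4)] unfolding is_tree_def by blast
  qed
  then show ?thesis using D(1) sub by blast
qed

section \<open>From drawings of rooted trees to drawings of the graph\<close>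

lemma mono_planar_monotone_drawing:
  assumes "mono_planar V D p" "\<And>u v. (u, v) \<in> D \<union> D\<inverse> \<Longrightarrow> E u v"
  shows "monotone_drawing V E p"
  unfolding monotone_drawing_def
proof (intro ballI)
  fix u v assume "u \<in> V" "v \<in> V"
  then obtain d where d: "d \<noteq> 0" "(ascent D p d)\<^sup>*\<^sup>* u v" using assms(1) unfolding mono_planar_def by blast
  then obtain xs where xs: "xs \<noteq> []" "hd xs = u" "last xs = v" "successively (ascent D p d) xs"
    using rtranclp_walk by metis
  have "graph_walk E xs" "monotone_path p xs"
    using successively_nth[OF xs(4)] assms(2) d(1)
    unfolding graph_walk_def monotone_path_def inner_rpos ascent_def by blast+
  then show "\<exists>xs. xs \<noteq> [] \<and> hd xs = u \<and> last xs = v \<and> graph_walk E xs \<and> monotone_path p xs"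
    using xs by blast
qed

lemma mono_planar_planar_drawing:
  assumes "mono_planar V D p" "\<And>u v. E u v \<Longrightarrow> (u, v) \<in> D \<union> D\<inverse>"
  shows "planar_drawing E p"
  unfolding planar_drawing_def
proof (intro allI impI)
  fix a b c d assume *: "E a b" "E c d" "{a, b} \<noteq> {c, d}"
  have orient: "\<exists>e\<in>D. closed_segment (rpos p u) (rpos p v) = closed_segment (rpos p (fst e)) (rpos p (snd e)) \<and>
      {u, v} = {fst e, snd e}" if "E u v" for u v
  proof (cases "(u, v) \<in> D")
    case False
    then have "(v, u) \<in> D" using assms(2)[OF that] by auto
    then show ?thesis by (rule bexI[rotated]) (auto simp: closed_segment_commute)
  qed (rule bexI[of _ "(u, v)"], simp_all)
  obtain e f where e: "e \<in> D" "closed_segment (rpos p a) (rpos p b) = closed_segment (rpos p (fst e)) (rpos p (snd e))"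
      "{a, b} = {fst e, snd e}"
    and f: "f \<in> D" "closed_segment (rpos p c) (rpos p d) = closed_segment (rpos p (fst f)) (rpos p (snd f))"
      "{c, d} = {fst f, snd f}"
    using orient[OF *(1)] orient[OF *(2)] by blast
  have "e \<noteq> f" using *(3) e(3) f(3) by auto
  then have "segs_meet p e f" using assms(1) e(1) f(1) unfolding mono_planar_def by blast
  then show "closed_segment (rpos p a) (rpos p b) \<inter> closed_segment (rpos p c) (rpos p d) \<subseteq> rpos p ` ({a, b} \<inter> {c, d})"
    unfolding segs_meet_def e(2,3) f(2,3) .
qed

lemma mono_planar_inj_on:
  assumes "mono_planar V D p"
  shows "inj_on p V"
proof (rule inj_onI)
  fix u v assume uv: "u \<in> V" "v \<in> V" "p u = p v"
  then obtain d where "(ascent D p d)\<^sup>*\<^sup>* u v" using assms unfolding mono_planar_def by blast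
  then show "u = v" using ascent_less[of D p d u v] uv(3) by simp
qed

text \<open>For \<open>n = m + 1\<close> the bound \<open>3 / 4 * m + 5 / 4\<close> equals
  \<open>3 / 4 * (n + 2) - 1\<close>. The slack over \<open>3 / 4 * m\<close> serves the case
  \<open>m <= 1\<close>, which \<open>ex_balanced_split\<close> does not cover.\<close>

lemma rooted_tree_compact_drawing:
  assumes t: "rooted_tree m r V D"
  shows "\<exists>p D'. mono_planar V D' p \<and> D' \<union> D'\<inverse> = D \<union> D\<inverse> \<and> (\<forall>v\<in>V. in_box (0, 0) (3 / 4 * real m + 5 / 4) (p v))"
proof (cases "2 \<le> m")
  case False
  \<comment> \<open>Length 3/2 is the longest allowed and turns the bound of \<open>drawable\<close>
    into \<open>m\<close>.\<close>
  have "wide 0 (3 / 2)" unfolding wide_def by (auto intro: exI[of _ 0])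
  then obtain p where "drawing (0, 0) r V D 0 (3 / 2) (3 / 2 * real m / (3 / 2 - 0)) p"
    using rooted_tree_drawable[OF t] unfolding drawable_def by blast
  then have "mono_planar V D p" "\<forall>v\<in>V. in_box (0, 0) (real m) (p v)" by (auto simp: drawing_def)
  moreover have "real m \<le> 3 / 4 * real m + 5 / 4" using False by simp
  ultimately show ?thesis unfolding in_box_def by force
next
  case True
  \<comment> \<open>The search for the split starts with the whole tree on one side and the root
    alone on the other.\<close>
  have "balanced_split (m + 0) (V \<union> {r}) (D \<union> {})"
    using True rooted_tree_root[OF t] by (intro ex_balanced_split[OF t rooted_tree.single]) auto
  moreover have "V \<union> {r} = V" using rooted_tree_root[OF t] by blast
  ultimately have "balanced_split m V D" by simp
  then obtain a b u A B DA DB where A: "rooted_tree a u A DA" and B: "rooted_tree b u B DB"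
    and AB: "A \<inter> B = {u}" and ab: "b \<le> a" "a + b = m" "4 * a \<le> 3 * m" "A \<union> B = V"
    and D: "(DA \<union> DB) \<union> (DA \<union> DB)\<inverse> = D \<union> D\<inverse>"
    unfolding balanced_split_def by blast
  \<comment> \<open>The quadrant of length 2 is shared in proportion to the numbers of edges. With
    the lighter part first, \<open>c <= 1\<close>, so its sector contains the integer 0 and the
    other one contains 1; \<open>2 - c <= 3 / 2\<close> is the balance condition.\<close>
  define c where "c = 2 * real b / real m"
  have m: "real m = real a + real b" "0 < real m" using ab(2) True by auto
  have "0 < b" using ab True by linarith
  then have c: "0 < c" "c \<le> 1" "2 - c \<le> 3 / 2"
    using ab m by (auto simp: c_def field_simps)
  have c2: "2 - c = 2 * real a / real m" using m by (simp add: c_def field_simps)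
  have "wide 0 c" unfolding wide_def using c by (auto intro: exI[of _ 0])
  moreover have "3 / 2 * real b / (c - 0) = 3 / 4 * real m" using \<open>0 < b\<close> m by (simp add: c_def)
  ultimately obtain q where q: "drawing (0, 0) u B DB 0 c (3 / 4 * real m) q"
    using rooted_tree_drawable[OF B] unfolding drawable_def by metis
  have "wide c 2" unfolding wide_def using c by (auto intro!: disjI2 exI[of _ 1])
  moreover have "3 / 2 * real a / (2 - c) = 3 / 4 * real m" unfolding c2 using \<open>0 < b\<close> ab m by simp
  ultimately obtain p where p: "drawing (0, 0) u A DA c 2 (3 / 4 * real m) p"
    using rooted_tree_drawable[OF A] unfolding drawable_def by metis
  have "\<exists>g. drawing (0, 0) u (B \<union> A) (DB \<union> DA) 0 2 (3 / 4 * real m) g"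
    using AB c by (intro drawing_join[OF B A _ _ _ _ _ q p]) (simp_all add: Int_commute)
  then obtain g where "drawing (0, 0) u (B \<union> A) (DB \<union> DA) 0 2 (3 / 4 * real m) g" ..
  then have "mono_planar V (DA \<union> DB) g" "\<forall>v\<in>V. in_box (0, 0) (3 / 4 * real m) (g v)"
    using ab(4) by (auto simp: drawing_def Un_commute)
  then show ?thesis using D unfolding in_box_def by force
qed

theorem theorem6:
  fixes V :: "'a set" and E :: "'a \<Rightarrow> 'a \<Rightarrow> bool" and n :: nat
  assumes "is_tree V E" and "card V = n" and "n \<ge> 1"
  shows "\<exists>p :: 'a \<Rightarrow> int \<times> int. \<exists>x0 y0 :: int.
           inj_on p V \<and> monotone_drawing V E p \<and> planar_drawing E p \<and>
           (\<forall>v\<in>V. x0 \<le> fst (p v) \<and> fst (p v) \<le> x0 + \<lfloor>3 / 4 * (real n + 2)\<rfloor> - 1 \<and>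
                   y0 \<le> snd (p v) \<and> snd (p v) \<le> y0 + \<lfloor>3 / 4 * (real n + 2)\<rfloor> - 1)"
proof -
  obtain m r D where t: "rooted_tree m r V D" and E: "\<forall>u v. E u v \<longleftrightarrow> (u, v) \<in> D \<union> D\<inverse>"
    using tree_rooted_tree[OF assms(1)] by blast
  obtain p D' where p: "mono_planar V D' p" and D': "D' \<union> D'\<inverse> = D \<union> D\<inverse>"
    and box: "\<forall>v\<in>V. in_box (0, 0) (3 / 4 * real m + 5 / 4) (p v)"
    using rooted_tree_compact_drawing[OF t] by blast
  have nm: "real n = real m + 1" using rooted_tree_card[OF t] assms(2) by simp
  \<comment> \<open>An integer at most \<open>3 / 4 * (n + 2) - 1\<close> stays below the floor by
    at least 1, which matches the 1 subtracted in the claim.\<close>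
  have fl: "i \<le> 0 + \<lfloor>3 / 4 * (real n + 2)\<rfloor> - 1" if "of_int i \<le> 3 / 4 * real m + 5 / 4" for i :: int
  proof -
    have "of_int (i + 1) \<le> 3 / 4 * (real n + 2)" using that nm by simp
    then have "i + 1 \<le> \<lfloor>3 / 4 * (real n + 2)\<rfloor>" by (simp only: le_floor_iff)
    then show ?thesis by linarith
  qed
  have "inj_on p V" using p by (rule mono_planar_inj_on)
  moreover have "monotone_drawing V E p" using p by (rule mono_planar_monotone_drawing) (simp only: D' E)
  moreover have "planar_drawing E p" using p by (rule mono_planar_planar_drawing) (simp only: D' E)
  moreover have "\<forall>v\<in>V. 0 \<le> fst (p v) \<and> fst (p v) \<le> 0 + \<lfloor>3 / 4 * (real n + 2)\<rfloor> - 1 \<and>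
      0 \<le> snd (p v) \<and> snd (p v) \<le> 0 + \<lfloor>3 / 4 * (real n + 2)\<rfloor> - 1"
  proof (intro ballI conjI)
    fix v assume "v \<in> V"
    then have "in_box (0, 0) (3 / 4 * real m + 5 / 4) (p v)" using box by blast
    then have *: "0 \<le> fst (p v)" "of_int (fst (p v)) \<le> 3 / 4 * real m + 5 / 4"
      "0 \<le> snd (p v)" "of_int (snd (p v)) \<le> 3 / 4 * real m + 5 / 4" by (simp_all add: in_box_def)
    show "0 \<le> fst (p v)" "0 \<le> snd (p v)" by (fact *)+
    show "fst (p v) \<le> 0 + \<lfloor>3 / 4 * (real n + 2)\<rfloor> - 1" using *(2) by (rule fl)
    show "snd (p v) \<le> 0 + \<lfloor>3 / 4 * (real n + 2)\<rfloor> - 1" using *(4) by (rule fl)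
  qed
  ultimately show ?thesis by (intro exI[of _ p] exI[of _ "0 :: int"] conjI)
qed

end
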